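(* There is a function $g$ with $g(n)/n^2\to 0$ as $n\to\infty$ such that for every odd $n\ge 7$, the diameter of the pair digraph of the automaton $\mathcal{F}_n$ is at least $\frac{n^2}{4}+g(n)$.
   Context: For a DFA with permutation letters on state set $Q$, the pair digraph has as vertices the unordered pairs $\{p,q\}$ of distinct states and an edge from $\{p,q\}$ to $\{p\cdot c,q\cdot c\}$ for each letter $c$; its diameter is the maximum over ordered pairs of vertices of the length of a shortest directed path between them. For odd $n\ge7$, the automaton $\mathcal{F}_n$ has states $q_1,\dots,q_n$ and two letters $a,b$, both permutations, defined as follows (every state not mentioned for a letter is fixed by it): $a$ acts as the 4-cycle $q_1\to q_2\to q_3\to q_4\to q_1$; $b$ swaps $q_1$ and $q_6$; for each $1\le i\le\frac{n-3}{2}$, the states $q_{2i+1}$ and $q_{2i+3}$ are swapped by $b$ if $i$ is odd and by $a$ if $i$ is even; for each $3\le j\le\frac{n-3}{2}$, the states $q_{2j}$ and $q_{2j+2}$ are swapped by $a$ if $j$ is odd and by $b$ if $j$ is even. (Thus $a$: $q_1\to q_2\to q_3\to q_4\to q_1$, $q_5\leftrightarrow q_7$, $q_6\leftrightarrow q_8$, \dots; $b$: $q_1\leftrightarrow q_6$, $q_3\leftrightarrow q_5$, $q_7\leftrightarrow q_9$, $q_8\leftrightarrow q_{10}$, \dots, fixing $q_2,q_4$.) *)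

theory Defs
  imports Complex_Main "HOL-Library.Extended_Real"
begin

text \<open>A transposition-style action: S is a set of disjoint pairs (p,q); each pair is swapped,
  every other state is fixed.\<close>
definition swap_act :: "(nat \<times> nat) set \<Rightarrow> nat \<Rightarrow> nat" where
  "swap_act S q =
     (if \<exists>p. (q, p) \<in> S then (THE p. (q, p) \<in> S)
      else if \<exists>p. (p, q) \<in> S then (THE p. (p, q) \<in> S)
      else q)"

definition a_swaps :: "nat \<Rightarrow> (nat \<times> nat) set" where
  "a_swaps n =
     {(2*i+1, 2*i+3) | i. 1 \<le> i \<and> i \<le> (n - 3) div 2 \<and> even i}
   \<union> {(2*j, 2*j+2) | j. 3 \<le> j \<and> j \<le> (n - 3) div 2 \<and> odd j}"

definition b_swaps :: "nat \<Rightarrow> (nat \<times> nat) set" where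
  "b_swaps n =
     {(1, 6)}
   \<union> {(2*i+1, 2*i+3) | i. 1 \<le> i \<and> i \<le> (n - 3) div 2 \<and> odd i}
   \<union> {(2*j, 2*j+2) | j. 3 \<le> j \<and> j \<le> (n - 3) div 2 \<and> even j}"

text \<open>Letter a of F_n (state q_k is the number k).\<close>
definition F_a :: "nat \<Rightarrow> nat \<Rightarrow> nat" where
  "F_a n q = (if q \<in> {1..4} then (if q = 4 then 1 else q + 1) else swap_act (a_swaps n) q)"

definition F_b :: "nat \<Rightarrow> nat \<Rightarrow> nat" where
  "F_b n q = swap_act (b_swaps n) q"

definition pair_vertices :: "nat \<Rightarrow> nat set set" where
  "pair_vertices n = {P. P \<subseteq> {1..n} \<and> card P = 2}"

definition pair_edges :: "nat \<Rightarrow> (nat set \<times> nat set) set" where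
  "pair_edges n = {(P, f ` P) | P f. P \<in> pair_vertices n \<and> f \<in> {F_a n, F_b n}}"

text \<open>Length of a shortest directed path (infinity if none).\<close>
definition pair_dist :: "nat \<Rightarrow> nat set \<Rightarrow> nat set \<Rightarrow> enat" where
  "pair_dist n u v = (INF k \<in> {k. (u, v) \<in> (pair_edges n) ^^ k}. enat k)"

definition pair_diameter :: "nat \<Rightarrow> enat" where
  "pair_diameter n = (SUP uv \<in> pair_vertices n \<times> pair_vertices n. pair_dist n (fst uv) (snd uv))"

end

theory Submission
  imports Defs
begin

text \<open>
  Away from the ends of the two tails, both letters act as reflections of the integers in a suitable
  coordinate \<open>pos\<close>: \<open>a\<close> is \<open>x \<mapsto> -2 - x\<close> and \<open>b\<close> is \<open>x \<mapsto> -x\<close>. At the end of a tail the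
  reflection law fails by \<open>n + 1\<close> (odd tail) or \<open>n - 1\<close> (even tail), so modulo \<open>n\<close> the
  difference \<open>e\<close> of the coordinates of a pair is preserved up to sign except for changes by 1 at the
  ends. Between two changes in the same sense caused by the same member of the pair, that member must
  travel from a tail end through the 4-cycle to a tail end, which takes about \<open>n\<close> letters. This is
  captured by a correction term \<open>corr\<close>: each letter changes the absolute value of
  \<open>(n - 2) e + corr p - corr q\<close> by at most 2. The factor is \<open>n - 2\<close> because \<open>2 * corr\<close> is
  \<open>n - 1\<close> or \<open>n - 3\<close>, up to sign, at the two tail ends. The quantity vanishes at \<open>{2, 4}\<close> and is
  about \<open>n\<^sup>2/2\<close>, up to sign, at \<open>{2, n}\<close>.
\<close>

section \<open>Coordinates on the two tails\<close>

text \<open>Distance to the state (1 or 3) at which the tail is attached to the 4-cycle; junk at 2 and 4.\<close>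
definition depth :: "nat \<Rightarrow> nat" where
  "depth q = (if q = 1 then 0 else if odd q then (q - 3) div 2 else (q - 4) div 2)"

text \<open>Both tails are folded onto the same integers: outwards from 1 or from 3 the values run
  -2, 2, -4, 4, and so on.\<close>

definition pos :: "nat \<Rightarrow> int" where
  "pos q = (if q = 2 \<or> q = 4 then 0
            else if even (depth q) then - int (depth q) - 2 else int (depth q) + 1)"

text \<open>Along a tail the sign alternates and the absolute value grows by 1, so neighbours cancel
  up to 1. The two tails carry opposite signs, with -1 at state 1 and 1 at state 3.\<close>

definition corr :: "nat \<Rightarrow> int" where
  "corr q = (if q = 2 \<or> q = 4 then 0
             else if even (depth q) = (odd q \<and> q \<noteq> 1) then int (depth q) + 1
             else - int (depth q) - 1)"

text \<open>\<open>d\<close> is the defect, modulo \<open>n\<close>, of the reflection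
  \<open>x \<mapsto> A - x\<close> sending \<open>p\<close> to \<open>q\<close>. Written with sums,
  the condition is symmetric, so one orientation of each swap suffices.\<close>

definition almost_reflected :: "nat \<Rightarrow> int \<Rightarrow> nat \<Rightarrow> nat \<Rightarrow> bool" where
  "almost_reflected n A p q \<longleftrightarrow>
     (\<exists>m d. pos p + pos q = A + int n * m + d \<and> \<bar>(int n - 2) * d + corr p + corr q\<bar> \<le> 1)"

lemma almost_reflected_sym: "almost_reflected n A p q \<Longrightarrow> almost_reflected n A q p"
  unfolding almost_reflected_def by (simp add: add.commute add.left_commute)

lemma almost_reflectedI:
  "pos p + pos q = A \<Longrightarrow> \<bar>corr p + corr q\<bar> \<le> 1 \<Longrightarrow> almost_reflected n A p q"
  unfolding almost_reflected_def by (intro exI[of _ 0]) auto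

lemma swap_act_cases:
  assumes "\<And>q p p'. (q, p) \<in> S \<Longrightarrow> (q, p') \<in> S \<Longrightarrow> p = p'"
    and "\<And>q p p'. (p, q) \<in> S \<Longrightarrow> (p', q) \<in> S \<Longrightarrow> p = p'"
  obtains "(q, swap_act S q) \<in> S" | "(swap_act S q, q) \<in> S"
    | "swap_act S q = q" "\<And>p. (q, p) \<notin> S" "\<And>p. (p, q) \<notin> S"
proof (cases "\<exists>p. (q, p) \<in> S")
  case True
  then obtain p where "(q, p) \<in> S" by blast
  then have "swap_act S q = p" unfolding swap_act_def using assms(1) by auto
  then show ?thesis using that \<open>(q, p) \<in> S\<close> by blast
next
  case no_right: False
  show ?thesis
  proof (cases "\<exists>p. (p, q) \<in> S")
    case True
    then obtain p where "(p, q) \<in> S" by blast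
    then have "swap_act S q = p" unfolding swap_act_def using assms(2) no_right by auto
    then show ?thesis using that \<open>(p, q) \<in> S\<close> by blast
  next
    case False
    then show ?thesis using no_right that unfolding swap_act_def by auto
  qed
qed

section \<open>Reflection law for swapped states\<close>

lemma int_depth_odd: "1 \<le> i \<Longrightarrow> int (depth (2 * i + 1)) = int i - 1"
  by (auto simp: depth_def)

lemma int_depth_even: "2 \<le> j \<Longrightarrow> int (depth (2 * j)) = int j - 2"
  by (auto simp: depth_def)

text \<open>Adjacent depths differ in parity, so both \<open>pos\<close> and \<open>corr\<close>
  change sign between the two states; the defect is 0.\<close>

lemma odd_tail_reflected:
  assumes "1 \<le> i"
  shows "almost_reflected n (if even i then - 2 else 0) (2 * i + 1) (2 * i + 3)"
proof (rule almost_reflectedI)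
  have d: "int (depth (2 * i + 1)) = int i - 1" "int (depth (2 * i + 3)) = int i"
    using int_depth_odd[of i] assms by (simp_all add: depth_def)
  have "even (depth (2 * i + 1)) \<longleftrightarrow> odd i" "even (depth (2 * i + 3)) \<longleftrightarrow> even i"
    using d by presburger+
  moreover have "2 * i + 1 \<notin> {1, 2, 4}" "2 * i + 3 \<notin> {1, 2, 4}"
    using assms by (simp_all, presburger+)
  ultimately show "pos (2 * i + 1) + pos (2 * i + 3) = (if even i then - 2 else 0)"
    "\<bar>corr (2 * i + 1) + corr (2 * i + 3)\<bar> \<le> 1"
    unfolding pos_def corr_def d by auto
qed

lemma even_tail_reflected:
  assumes "3 \<le> j"
  shows "almost_reflected n (if odd j then - 2 else 0) (2 * j) (2 * j + 2)"
proof (rule almost_reflectedI)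
  have d: "int (depth (2 * j)) = int j - 2" "int (depth (2 * j + 2)) = int j - 1"
    using int_depth_even[of j] int_depth_even[of "j + 1"] assms by (simp_all add: algebra_simps)
  have "even (depth (2 * j)) \<longleftrightarrow> even j" "even (depth (2 * j + 2)) \<longleftrightarrow> odd j"
    using d by presburger+
  moreover have "2 * j \<notin> {1, 2, 4}" "2 * j + 2 \<notin> {1, 2, 4}" using assms by auto
  ultimately show "pos (2 * j) + pos (2 * j + 2) = (if odd j then - 2 else 0)"
    "\<bar>corr (2 * j) + corr (2 * j + 2)\<bar> \<le> 1"
    unfolding pos_def corr_def d by auto
qed

lemma a_swaps_reflected:
  assumes "(p, q) \<in> a_swaps n"
  shows "almost_reflected n (-2) p q"
proof -
  consider i where "1 \<le> i" "even i" "p = 2 * i + 1" "q = 2 * i + 3"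
    | j where "3 \<le> j" "odd j" "p = 2 * j" "q = 2 * j + 2"
    using assms unfolding a_swaps_def by blast
  then show ?thesis
    by cases (use odd_tail_reflected[of _ n] even_tail_reflected[of _ n] in \<open>metis (full_types)\<close>)+
qed

lemma b_swaps_reflected:
  assumes "(p, q) \<in> b_swaps n"
  shows "almost_reflected n 0 p q"
proof -
  consider "p = 1" "q = 6"
    | i where "1 \<le> i" "odd i" "p = 2 * i + 1" "q = 2 * i + 3"
    | j where "3 \<le> j" "even j" "p = 2 * j" "q = 2 * j + 2"
    using assms unfolding b_swaps_def by blast
  then show ?thesis
  proof cases
    case 1
    then show ?thesis by (auto intro!: almost_reflectedI simp: pos_def corr_def depth_def)
  qed (use odd_tail_reflected[of _ n] even_tail_reflected[of _ n] in \<open>metis (full_types)\<close>)+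
qed

section \<open>Fixed states at the tail ends\<close>

text \<open>\<open>A\<close> belongs to the letter that fixes the end: \<open>b\<close> at even
  depth, \<open>a\<close> at odd depth.\<close>

lemma tail_end_reflected:
  assumes "n = 2 * N + 1" "N \<ge> 3" and "q = n \<or> q = n - 1"
    and "A = (if even (depth q) then 0 else - 2)"
  shows "almost_reflected n A q q"
proof -
  \<comment> \<open>\<open>2 * pos q - A\<close> is \<open>s * (n + 1)\<close> at \<open>n\<close>
    and \<open>s * (n - 1)\<close> at \<open>n - 1\<close>; \<open>d\<close> is what remains after
    removing \<open>n * s\<close>.\<close>
  define s :: int where "s = (if even (depth q) then - 1 else 1)"
  define d :: int where "d = (if q = n then s else - s)"
  have q: "q \<noteq> 1" "q \<noteq> 2" "q \<noteq> 4" "odd q \<longleftrightarrow> q = n" using assms by auto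
  have depth: "int (depth q) = (if q = n then int N - 1 else int N - 2)"
    using assms by (auto simp: depth_def)
  have "pos q + pos q = A + int n * s + d"
    using assms q depth by (auto simp: pos_def s_def d_def)
  moreover have "\<bar>(int n - 2) * d + corr q + corr q\<bar> \<le> 1"
    using assms q depth by (auto simp: corr_def s_def d_def)
  ultimately show ?thesis unfolding almost_reflected_def by blast
qed

lemma a_swaps_memI:
  "even i \<Longrightarrow> 1 \<le> i \<Longrightarrow> i \<le> (n - 3) div 2 \<Longrightarrow> (2 * i + 1, 2 * i + 3) \<in> a_swaps n"
  "odd j \<Longrightarrow> 3 \<le> j \<Longrightarrow> j \<le> (n - 3) div 2 \<Longrightarrow> (2 * j, 2 * j + 2) \<in> a_swaps n"
  unfolding a_swaps_def by blast+

lemma b_swaps_memI: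
  "(1, 6) \<in> b_swaps n"
  "odd i \<Longrightarrow> 1 \<le> i \<Longrightarrow> i \<le> (n - 3) div 2 \<Longrightarrow> (2 * i + 1, 2 * i + 3) \<in> b_swaps n"
  "even j \<Longrightarrow> 3 \<le> j \<Longrightarrow> j \<le> (n - 3) div 2 \<Longrightarrow> (2 * j, 2 * j + 2) \<in> b_swaps n"
  unfolding b_swaps_def by blast+

text \<open>The parity of the index decides whether \<open>a\<close> pairs \<open>q\<close> with its
  inner or its outer neighbour. Only a missing outer neighbour leaves \<open>q\<close>
  fixed.\<close>

lemma a_unswapped_tail_end:
  assumes n: "n = 2 * N + 1" "N \<ge> 3" and q: "4 < q" "q \<le> n"
    and unswapped: "\<And>p. (q, p) \<notin> a_swaps n" "\<And>p. (p, q) \<notin> a_swaps n"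
  shows "(q = n \<or> q = n - 1) \<and> odd (depth q)"
proof (cases "odd q")
  case True
  then obtain i where i: "q = 2 * i + 1" by (elim oddE)
  have "even i"
  proof (rule ccontr)
    assume "odd i"
    then have "(2 * (i - 1) + 1, 2 * (i - 1) + 3) \<in> a_swaps n"
      using n q i by (intro a_swaps_memI) (auto elim!: oddE)
    moreover have "2 * (i - 1) + 3 = q" using q i by simp
    ultimately show False using unswapped(2) by metis
  qed
  then have "\<not> i \<le> (n - 3) div 2" using unswapped(1) a_swaps_memI(1)[of i n] q i by auto
  \<comment> \<open>\<open>(n - 3) div 2\<close> is \<open>N - 1\<close>.\<close>
  then have "i = N" using n q i by auto
  have "int (depth q) = int i - 1" using int_depth_odd[of i] q i \<open>i = N\<close> n by simp
  then have "odd (depth q)" using \<open>even i\<close> by presburger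
  then show ?thesis using n i \<open>i = N\<close> by simp
next
  case False
  then obtain j where j: "q = 2 * j" by (auto elim: evenE)
  have "odd j"
  proof (rule ccontr)
    assume "\<not> odd j"
    then have "(2 * (j - 1), 2 * (j - 1) + 2) \<in> a_swaps n"
      using n q j by (intro a_swaps_memI) presburger+
    moreover have "2 * (j - 1) + 2 = q" using q j by simp
    ultimately show False using unswapped(2) by metis
  qed
  then have "\<not> j \<le> (n - 3) div 2" using unswapped(1) a_swaps_memI(2)[of j n] q j by auto
  then have "j = N" using n q j by auto
  have "int (depth q) = int j - 2" using int_depth_even[of j] q j \<open>j = N\<close> n by simp
  then have "odd (depth q)" using \<open>odd j\<close> by presburger
  then show ?thesis using n j \<open>j = N\<close> by simp
qed

lemma b_unswapped_tail_end:
  assumes n: "n = 2 * N + 1" "N \<ge> 3" and q: "1 \<le> q" "q \<le> n" "q \<noteq> 2" "q \<noteq> 4"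
    and unswapped: "\<And>p. (q, p) \<notin> b_swaps n" "\<And>p. (p, q) \<notin> b_swaps n"
  shows "(q = n \<or> q = n - 1) \<and> even (depth q)"
proof (cases "odd q")
  case True
  then obtain i where i: "q = 2 * i + 1" by (elim oddE)
  have "i > 0" using unswapped(1)[of 6] b_swaps_memI(1)[of n] i by (cases i) auto
  have "odd i"
  proof (rule ccontr)
    assume "\<not> odd i"
    then have "(2 * (i - 1) + 1, 2 * (i - 1) + 3) \<in> b_swaps n"
      using n q i \<open>i > 0\<close> by (intro b_swaps_memI) (auto elim!: evenE)
    moreover have "2 * (i - 1) + 3 = q" using \<open>i > 0\<close> i by simp
    ultimately show False using unswapped(2) by metis
  qed
  then have "\<not> i \<le> (n - 3) div 2"
    using unswapped(1) b_swaps_memI(2)[of i n] \<open>i > 0\<close> i by auto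
  then have "i = N" using n q i by auto
  have "int (depth q) = int i - 1" using int_depth_odd[of i] q i \<open>i = N\<close> n by simp
  then have "even (depth q)" using \<open>odd i\<close> by presburger
  then show ?thesis using n i \<open>i = N\<close> by simp
next
  case False
  then obtain j where j: "q = 2 * j" by (auto elim: evenE)
  have "j \<ge> 3" using q j by auto
  \<comment> \<open>The inner neighbour of 6 is 1, not 4, so this swap lies outside the regular
    family.\<close>
  have "j \<noteq> 3" using unswapped(2)[of 1] b_swaps_memI(1)[of n] j by auto
  have "even j"
  proof (rule ccontr)
    assume "odd j"
    then have "(2 * (j - 1), 2 * (j - 1) + 2) \<in> b_swaps n"
      using n q j \<open>j \<ge> 3\<close> \<open>j \<noteq> 3\<close> by (intro b_swaps_memI) presburger+
    moreover have "2 * (j - 1) + 2 = q" using \<open>j \<ge> 3\<close> j by simp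
    ultimately show False using unswapped(2) by metis
  qed
  then have "\<not> j \<le> (n - 3) div 2"
    using unswapped(1) b_swaps_memI(3)[of j n] \<open>j \<ge> 3\<close> j by auto
  then have "j = N" using n q j by auto
  have "int (depth q) = int j - 2" using int_depth_even[of j] q j \<open>j = N\<close> n by simp
  then have "even (depth q)" using \<open>even j\<close> by presburger
  then show ?thesis using n j \<open>j = N\<close> by simp
qed

lemma a_swaps_unique:
  "(q, p) \<in> a_swaps n \<Longrightarrow> (q, p') \<in> a_swaps n \<Longrightarrow> p = p'"
  "(p, q) \<in> a_swaps n \<Longrightarrow> (p', q) \<in> a_swaps n \<Longrightarrow> p = p'"
  unfolding a_swaps_def by auto

lemma b_swaps_unique:
  "(q, p) \<in> b_swaps n \<Longrightarrow> (q, p') \<in> b_swaps n \<Longrightarrow> p = p'"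
  "(p, q) \<in> b_swaps n \<Longrightarrow> (p', q) \<in> b_swaps n \<Longrightarrow> p = p'"
  unfolding b_swaps_def by auto presburger+

section \<open>Reflection law for the letters\<close>

lemma F_a_reflected:
  assumes n: "n = 2 * N + 1" "N \<ge> 3" and q: "q \<in> {1..n}"
  shows "almost_reflected n (-2) q (F_a n q)"
proof (cases "q \<le> 4")
  case True
  then consider "q = 1" | "q = 2" | "q = 3" | "q = 4" using q by fastforce
  then show ?thesis
    by cases (auto intro!: almost_reflectedI simp: F_a_def pos_def corr_def depth_def)
next
  case False
  then have F: "F_a n q = swap_act (a_swaps n) q" by (simp add: F_a_def)
  consider "(q, F_a n q) \<in> a_swaps n" | "(F_a n q, q) \<in> a_swaps n"
    | "F_a n q = q" "\<And>p. (q, p) \<notin> a_swaps n" "\<And>p. (p, q) \<notin> a_swaps n"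
    unfolding F by (rule swap_act_cases[of "a_swaps n" q, OF a_swaps_unique]; blast)
  then show ?thesis
  proof cases
    case 3
    then show ?thesis
      using a_unswapped_tail_end[OF n, of q] tail_end_reflected[OF n, of q] False q by auto
  qed (auto dest: a_swaps_reflected intro: almost_reflected_sym)
qed

lemma F_b_reflected:
  assumes n: "n = 2 * N + 1" "N \<ge> 3" and q: "q \<in> {1..n}"
  shows "almost_reflected n 0 q (F_b n q)"
proof -
  consider "(q, F_b n q) \<in> b_swaps n" | "(F_b n q, q) \<in> b_swaps n"
    | "F_b n q = q" "\<And>p. (q, p) \<notin> b_swaps n" "\<And>p. (p, q) \<notin> b_swaps n"
    unfolding F_b_def by (rule swap_act_cases[of "b_swaps n" q, OF b_swaps_unique]; blast)
  then show ?thesis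
  proof cases
    case 3
    show ?thesis
    proof (cases "q = 2 \<or> q = 4")
      case True
      then show ?thesis using 3 by (auto intro!: almost_reflectedI simp: pos_def corr_def)
    next
      case False
      then show ?thesis
        using 3 b_unswapped_tail_end[OF n, of q] tail_end_reflected[OF n, of q] q by auto
    qed
  qed (auto dest: b_swaps_reflected intro: almost_reflected_sym)
qed

section \<open>Growth of the offset along paths\<close>

text \<open>The order of the pair is immaterial: exchanging \<open>p\<close> and \<open>q\<close>
  and negating \<open>e\<close> and \<open>m\<close> only flips the sign inside the absolute
  value.\<close>

definition offset_bounded :: "nat \<Rightarrow> nat \<Rightarrow> nat set \<Rightarrow> bool" where
  "offset_bounded n k P \<longleftrightarrow>
     (\<exists>p q e m. P = {p, q} \<and> pos p - pos q = e + int n * m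
        \<and> \<bar>(int n - 2) * e + corr p - corr q\<bar> \<le> 2 * int k)"

text \<open>\<open>A\<close> cancels in the difference of the coordinates. The new quantity is the
  error at \<open>p\<close> minus the error at \<open>q\<close> minus the old quantity, and each
  error is at most 1 in absolute value.\<close>

lemma offset_bounded_reflected:
  assumes P: "offset_bounded n k P"
    and refl: "\<And>q. q \<in> P \<Longrightarrow> almost_reflected n A q (f q)"
  shows "offset_bounded n (Suc k) (f ` P)"
proof -
  obtain p q e m where pq: "P = {p, q}" and e: "pos p - pos q = e + int n * m"
    and bound: "\<bar>(int n - 2) * e + corr p - corr q\<bar> \<le> 2 * int k"
    using P unfolding offset_bounded_def by blast
  obtain m1 d1 where p1: "pos p + pos (f p) = A + int n * m1 + d1"
      "\<bar>(int n - 2) * d1 + corr p + corr (f p)\<bar> \<le> 1"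
    using refl[of p] pq unfolding almost_reflected_def by blast
  obtain m2 d2 where q2: "pos q + pos (f q) = A + int n * m2 + d2"
      "\<bar>(int n - 2) * d2 + corr q + corr (f q)\<bar> \<le> 1"
    using refl[of q] pq unfolding almost_reflected_def by blast
  have "f ` P = {f p, f q}" using pq by simp
  moreover have "pos (f p) - pos (f q) = (d1 - d2 - e) + int n * (m1 - m2 - m)"
    using e p1(1) q2(1) by (simp add: algebra_simps)
  moreover have "\<bar>(int n - 2) * (d1 - d2 - e) + corr (f p) - corr (f q)\<bar> \<le> 2 * int (Suc k)"
  proof -
    have "(int n - 2) * (d1 - d2 - e) + corr (f p) - corr (f q)
        = ((int n - 2) * d1 + corr p + corr (f p)) - ((int n - 2) * d2 + corr q + corr (f q))
          - ((int n - 2) * e + corr p - corr q)"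
      by (simp add: algebra_simps)
    moreover have "\<bar>x - y - z\<bar> \<le> 2 * int (Suc k)"
      if "\<bar>x\<bar> \<le> 1" "\<bar>y\<bar> \<le> 1" "\<bar>z\<bar> \<le> 2 * int k" for x y z :: int
      using that by simp
    ultimately show ?thesis using bound p1(2) q2(2) by presburger
  qed
  ultimately show ?thesis unfolding offset_bounded_def by blast
qed

lemma offset_bounded_reachable:
  assumes n: "n = 2 * N + 1" "N \<ge> 3" and "({2, 4}, P) \<in> pair_edges n ^^ k"
  shows "offset_bounded n k P"
  using assms(3)
proof (induction k arbitrary: P)
  case 0
  then show ?case
    unfolding offset_bounded_def
    by (intro exI[of _ 2] exI[of _ 4] exI[of _ 0]) (auto simp: pos_def corr_def)
next
  case (Suc k)
  then obtain R where R: "({2, 4}, R) \<in> pair_edges n ^^ k" "(R, P) \<in> pair_edges n"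
    by auto
  then have "R \<subseteq> {1..n}" and P: "P = F_a n ` R \<or> P = F_b n ` R"
    unfolding pair_edges_def pair_vertices_def by auto
  then show ?case
    using offset_bounded_reflected[OF Suc.IH[OF R(1)], of "-2" "F_a n"]
      offset_bounded_reflected[OF Suc.IH[OF R(1)], of 0 "F_b n"]
      F_a_reflected[OF n] F_b_reflected[OF n] by blast
qed

section \<open>Lower bound for the diameter\<close>

text \<open>All four values are congruent to \<open>N\<close> or \<open>- N\<close> modulo
  \<open>2 * N + 1\<close>, and the members of these classes nearest to 0 are \<open>N\<close> and
  \<open>- N\<close>.\<close>

lemma abs_residue_ge:
  fixes e m N :: int
  assumes "e + (2 * N + 1) * m \<in> {N, - N, N + 1, - N - 1}" "N \<ge> 0"
  shows "\<bar>e\<bar> \<ge> N"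
proof -
  define t where "t = (2 * N + 1) * m"
  consider "m = 0" | "m \<ge> 1" | "m \<le> - 1" by linarith
  then have "t = 0 \<or> 2 * N + 1 \<le> t \<or> t \<le> - (2 * N + 1)"
  proof cases
    case 2
    then show ?thesis using mult_left_mono[of 1 m "2 * N + 1"] assms(2) by (simp add: t_def)
  next
    case 3
    then show ?thesis using mult_left_mono[of m "- 1" "2 * N + 1"] assms(2) by (simp add: t_def)
  qed (simp add: t_def)
  then show ?thesis using assms unfolding t_def[symmetric] by auto
qed

lemma offset_bounded_last:
  assumes n: "n = 2 * N + 1" "N \<ge> 3" and "offset_bounded n k {2, n}"
  shows "N * (N - 1) \<le> k"
proof -
  obtain p q e m where pq: "{2, n} = {p, q}" and e: "pos p - pos q = e + int n * m"
    and bound: "\<bar>(int n - 2) * e + corr p - corr q\<bar> \<le> 2 * int k"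
    using assms(3) unfolding offset_bounded_def by blast
  have pq': "p = 2 \<and> q = n \<or> p = n \<and> q = 2" using pq by (auto simp: doubleton_eq_iff)
  have depth: "depth n = N - 1" using n by (simp add: depth_def)
  have pos: "pos n = int N \<or> pos n = - int N - 1" and corr: "\<bar>corr n\<bar> = int N"
    and zero: "pos 2 = 0" "corr 2 = 0"
    using n depth by (auto simp: pos_def corr_def)
  have e': "pos p - pos q = e + (2 * int N + 1) * m" using e n by simp
  have "e + (2 * int N + 1) * m \<in> {int N, - int N, int N + 1, - int N - 1}"
    using pq' pos zero n by (auto simp flip: e')
  then have "\<bar>e\<bar> \<ge> int N" by (rule abs_residue_ge) simp
  \<comment> \<open>With \<open>n - 2 = 2 * N - 1\<close>, moving the contribution \<open>N\<close>
    of \<open>corr n\<close> to the left leaves \<open>2 * N * (N - 1) \<le> 2 * k\<close>.\<close>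
  then have "(int n - 2) * int N \<le> (int n - 2) * \<bar>e\<bar>" using n by (intro mult_left_mono) auto
  also have "\<dots> = \<bar>(int n - 2) * e\<bar>" using n by (simp add: abs_mult)
  also have "\<dots> \<le> 2 * int k + int N" using bound corr zero pq' by auto
  finally have "int N * (int N - 1) \<le> int k" using n by (simp add: algebra_simps)
  moreover have "int (N * (N - 1)) = int N * (int N - 1)" using n by (simp add: of_nat_diff)
  ultimately show ?thesis by (metis of_nat_le_iff)
qed

lemma pair_diameter_ge:
  assumes n: "n = 2 * N + 1" "N \<ge> 3"
  shows "enat (N * (N - 1)) \<le> pair_diameter n"
proof -
  \<comment> \<open>Reachability need not be shown: without a path the infimum is infinite.\<close>
  have "enat (N * (N - 1)) \<le> pair_dist n {2, 4} {2, n}"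
    unfolding pair_dist_def
    using offset_bounded_last[OF n offset_bounded_reachable[OF n]] by (intro INF_greatest) auto
  also have "\<dots> \<le> pair_diameter n"
    unfolding pair_diameter_def
    by (rule SUP_upper2[of "({2, 4}, {2, n})"]) (use n in \<open>auto simp: pair_vertices_def\<close>)
  finally show ?thesis .
qed

theorem theorem5:
  shows "\<exists>g :: nat \<Rightarrow> real. (\<lambda>n. g n / (real n)^2) \<longlonglongrightarrow> 0 \<and>
           (\<forall>n. odd n \<and> n \<ge> 7 \<longrightarrow>
              ereal_of_enat (pair_diameter n) \<ge> ereal ((real n)^2 / 4 + g n))"
proof (intro exI conjI allI impI)
  \<comment> \<open>The witness is \<open>g n = - real n\<close>.\<close>
  have "(\<lambda>n. - (1 / real n)) \<longlonglongrightarrow> - 0"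
    by (intro tendsto_minus lim_1_over_n)
  moreover have "(\<lambda>n. - real n / (real n)\<^sup>2) = (\<lambda>n. - (1 / real n))"
    by (auto simp: power2_eq_square)
  ultimately show "(\<lambda>n. - real n / (real n)\<^sup>2) \<longlonglongrightarrow> 0" by simp
next
  fix n :: nat
  assume "odd n \<and> n \<ge> 7"
  then obtain N where n: "n = 2 * N + 1" "N \<ge> 3" by (auto elim: oddE)
  \<comment> \<open>\<open>N * (N - 1)\<close> equals \<open>(n - 1) * (n - 3) / 4\<close>, which
    exceeds the left side by 3/4.\<close>
  have "(real n)\<^sup>2 / 4 + - real n \<le> real (N * (N - 1))"
    using n by (simp add: power2_eq_square field_simps)
  then have "ereal ((real n)\<^sup>2 / 4 + - real n) \<le> ereal_of_enat (enat (N * (N - 1)))" by simp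
  also have "\<dots> \<le> ereal_of_enat (pair_diameter n)"
    using pair_diameter_ge[OF n] by (simp only: ereal_of_enat_le_iff)
  finally show "ereal ((real n)\<^sup>2 / 4 + - real n) \<le> ereal_of_enat (pair_diameter n)" .
qed

end
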